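(* Let $(M_t,G_t)_{t\ge1}$ be the univariate model with targets $\pi_T$, $T\in\mathbb N$, described in the context, let $(\ell_t)_{t\ge1}$ be positive scale factors, and assume that for every $T\in\mathbb N$ the density $\pi_T$ is twice continuously differentiable and, for all $s,t\in[T]$, $\partial_s\partial_t\log\pi_T$ is Lipschitz-continuous and bounded and $\pi_T(|\partial_t\log\pi_T|^4)<\infty$. Let $\mathcal I_{t|T}=\pi_T([\partial_t\log\pi_T]^2)$ and assume $$\mathcal I(\ell):=\sup_{T\in\mathbb N}\sup_{t\in[T]}\ell_t\,\mathcal I_{t|T}<\infty .$$ Then, for any $N\in\mathbb N$, the limiting RW-EHMM acceptance rates $\tilde\alpha_T^N(t)$ satisfy $$\inf_{T\in\mathbb N}\ \inf_{t\in[T]}\tilde\alpha^N_T(t)\ \ge\ \Bigl(1+\frac{\exp(\mathcal I(\ell))}{N}\Bigr)^{-1}>0 .$$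
   Context: Notation: $[n]=\{1,\dots,n\}$, $[n]_0=\{0,\dots,n\}$; $\partial_t$ is the derivative with respect to $x_t$; $\pi_T(\varphi)=\int\varphi\,\pi_T$; $\mathbf 1_N$ is the all-ones vector and $I_N$ the identity. Model. $M_1$ is a probability measure on $\mathbb R$ with Lebesgue density $m_1$; for $t\ge2$, $M_t$ is a Markov kernel on $\mathbb R$ with transition density $m_t(x,y)$; $G_t:\mathbb R\to(0,\infty)$ is measurable. $\pi_T$ is the probability measure (and its density) on $\mathbb R^T$ given by $\pi_T(x_{1:T})\propto m_1(x_1)G_1(x_1)\prod_{t=2}^T m_t(x_{t-1},x_t)G_t(x_t)$. (The full target in spatial dimension $D$ is the product $\pi_T^{\otimes D}$; the limits below are those obtained as $D\to\infty$.) Limiting law $\widetilde{\mathbb P}^N_T$. Let $\Sigma=\tfrac12(I_N+\mathbf 1_N\mathbf 1_N^{\mathsf T})$. Sample independently for $t\in[T]$ vectors $V_t=(V_t^1,\dots,V_t^N)\sim \mathrm N(-\tfrac12\ell_t\mathcal I_{t|T}\mathbf 1_N,\ \ell_t\mathcal I_{t|T}\Sigma)$, and given these sample $K_1,\dots,K_T$ conditionally independently with $K_t=k\in[N]_0$ having probability $\Psi^k(\{V_t^m\}_{m=1}^N)$, where $\Psi^k(\{h^m\}_{m=1}^N)=e^{h^k}/(1+\sum_{m=1}^N e^{h^m})$ with $h^0:=0$. The limiting acceptance rate is $\tilde\alpha^N_T(t)=\widetilde{\mathbb P}^N_T(K_t\ne0)$. *)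

theory Defs
  imports "HOL-Probability.Probability"
begin

section \<open>Calculus on \<open>\<real>\<^sup>T\<close>\<close>

text \<open>
  The dimension \<open>T\<close> varies inside the statement, so \<open>\<real>\<^sup>T\<close> is the carrier of the library's
  product space \<open>Pi\<^sub>M {1..T} (\<lambda>_. lborel)\<close>: extensional functions on \<open>{1..T}\<close>, with the product
  topology \<open>powertop_real {1..T}\<close> and the Euclidean distance given by \<open>L2_set\<close>.
\<close>

abbreviation Rn :: "nat \<Rightarrow> (nat \<Rightarrow> real) set" where
  "Rn T \<equiv> {1..T} \<rightarrow>\<^sub>E UNIV"

definition pdiff :: "nat \<Rightarrow> ((nat \<Rightarrow> real) \<Rightarrow> real) \<Rightarrow> (nat \<Rightarrow> real) \<Rightarrow> real" where
  "pdiff t f x = deriv (\<lambda>u. f (x(t := u))) (x t)"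

fun C_k :: "nat \<Rightarrow> nat \<Rightarrow> ((nat \<Rightarrow> real) \<Rightarrow> real) \<Rightarrow> bool" where
  "C_k 0 T f \<longleftrightarrow> continuous_map (powertop_real {1..T}) euclideanreal f"
| "C_k (Suc k) T f \<longleftrightarrow>
     continuous_map (powertop_real {1..T}) euclideanreal f \<and>
     (\<forall>t\<in>{1..T}.
        (\<forall>x\<in>Rn T. (\<lambda>u. f (x(t := u))) field_differentiable at (x t)) \<and>
        C_k k T (pdiff t f))"

definition lipschitz_Rn :: "nat \<Rightarrow> ((nat \<Rightarrow> real) \<Rightarrow> real) \<Rightarrow> bool" where
  "lipschitz_Rn T f \<longleftrightarrow>
     (\<exists>L. \<forall>x\<in>Rn T. \<forall>y\<in>Rn T. \<bar>f x - f y\<bar> \<le> L * L2_set (\<lambda>i. x i - y i) {1..T})"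


section \<open>The univariate model and its targets\<close>

definition unnorm_target ::
  "(real \<Rightarrow> real) \<Rightarrow> (nat \<Rightarrow> real \<Rightarrow> real \<Rightarrow> real) \<Rightarrow> (nat \<Rightarrow> real \<Rightarrow> real) \<Rightarrow>
   nat \<Rightarrow> (nat \<Rightarrow> real) \<Rightarrow> real" where
  "unnorm_target m1 m G T x =
     m1 (x 1) * G 1 (x 1) * (\<Prod>t=2..T. m t (x (t - 1)) (x t) * G t (x t))"

definition norm_const ::
  "(real \<Rightarrow> real) \<Rightarrow> (nat \<Rightarrow> real \<Rightarrow> real \<Rightarrow> real) \<Rightarrow> (nat \<Rightarrow> real \<Rightarrow> real) \<Rightarrow>
   nat \<Rightarrow> ennreal" where
  "norm_const m1 m G T =
     (\<integral>\<^sup>+ x. ennreal (unnorm_target m1 m G T x) \<partial>(\<Pi>\<^sub>M t\<in>{1..T}. lborel))"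

definition target_density ::
  "(real \<Rightarrow> real) \<Rightarrow> (nat \<Rightarrow> real \<Rightarrow> real \<Rightarrow> real) \<Rightarrow> (nat \<Rightarrow> real \<Rightarrow> real) \<Rightarrow>
   nat \<Rightarrow> (nat \<Rightarrow> real) \<Rightarrow> real" where
  "target_density m1 m G T x = unnorm_target m1 m G T x / enn2real (norm_const m1 m G T)"

definition target ::
  "(real \<Rightarrow> real) \<Rightarrow> (nat \<Rightarrow> real \<Rightarrow> real \<Rightarrow> real) \<Rightarrow> (nat \<Rightarrow> real \<Rightarrow> real) \<Rightarrow>
   nat \<Rightarrow> (nat \<Rightarrow> real) measure" where
  "target m1 m G T =
     density (\<Pi>\<^sub>M t\<in>{1..T}. lborel) (\<lambda>x. ennreal (target_density m1 m G T x))"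

text \<open>
  The initial law and the kernels enter only through their densities. The last conjunct says that
  the targets can be normalised, i.e. that they are probability measures.
\<close>

definition feynman_kac_model ::
  "(real \<Rightarrow> real) \<Rightarrow> (nat \<Rightarrow> real \<Rightarrow> real \<Rightarrow> real) \<Rightarrow> (nat \<Rightarrow> real \<Rightarrow> real) \<Rightarrow> bool" where
  "feynman_kac_model m1 m G \<longleftrightarrow>
     m1 \<in> borel_measurable borel \<and> (\<forall>x. 0 \<le> m1 x) \<and>
     prob_space (density lborel (\<lambda>x. ennreal (m1 x))) \<and>
     (\<forall>t\<ge>2. (\<lambda>(x, y). m t x y) \<in> borel_measurable (borel \<Otimes>\<^sub>M borel) \<and>
        (\<forall>x y. 0 \<le> m t x y) \<and>
        (\<forall>x. prob_space (density lborel (\<lambda>y. ennreal (m t x y))))) \<and>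
     (\<forall>t\<ge>1. G t \<in> borel_measurable borel \<and> (\<forall>x. 0 < G t x)) \<and>
     (\<forall>T\<ge>1. 0 < norm_const m1 m G T \<and> norm_const m1 m G T < \<infinity>)"

definition log_target ::
  "(real \<Rightarrow> real) \<Rightarrow> (nat \<Rightarrow> real \<Rightarrow> real \<Rightarrow> real) \<Rightarrow> (nat \<Rightarrow> real \<Rightarrow> real) \<Rightarrow>
   nat \<Rightarrow> (nat \<Rightarrow> real) \<Rightarrow> real" where
  "log_target m1 m G T x = ln (target_density m1 m G T x)"

definition fisher_info ::
  "(real \<Rightarrow> real) \<Rightarrow> (nat \<Rightarrow> real \<Rightarrow> real \<Rightarrow> real) \<Rightarrow> (nat \<Rightarrow> real \<Rightarrow> real) \<Rightarrow>
   nat \<Rightarrow> nat \<Rightarrow> real" where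
  "fisher_info m1 m G T t =
     (\<integral>x. (pdiff t (log_target m1 m G T) x)\<^sup>2 \<partial>target m1 m G T)"


section \<open>The limiting law and acceptance rates\<close>

text \<open>
  \<open>N(\<mu>, C)\<close> on \<open>\<real>\<^sup>N\<close> is the law of \<open>\<mu> + A Z\<close> for \<open>Z\<close> standard normal and any \<open>A\<close> with
  \<open>A A\<^sup>T = C\<close>. Such an \<open>A\<close> exists when \<open>C\<close> is symmetric and positive semidefinite
  (a singular \<open>C\<close> is allowed), and the law does not depend on which one is chosen.
\<close>

definition is_factor :: "nat \<Rightarrow> (nat \<Rightarrow> nat \<Rightarrow> real) \<Rightarrow> (nat \<Rightarrow> nat \<Rightarrow> real) \<Rightarrow> bool" where
  "is_factor N C A \<longleftrightarrow> (\<forall>i\<in>{1..N}. \<forall>j\<in>{1..N}. (\<Sum>k=1..N. A i k * A j k) = C i j)"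

definition mv_normal :: "nat \<Rightarrow> (nat \<Rightarrow> real) \<Rightarrow> (nat \<Rightarrow> nat \<Rightarrow> real) \<Rightarrow> (nat \<Rightarrow> real) measure" where
  "mv_normal N \<mu> C =
     (let A = (SOME A. is_factor N C A)
      in distr (\<Pi>\<^sub>M k\<in>{1..N}. std_normal_distribution) (\<Pi>\<^sub>M i\<in>{1..N}. borel)
           (\<lambda>z. \<lambda>i\<in>{1..N}. \<mu> i + (\<Sum>k=1..N. A i k * z k)))"

definition Sigma_mat :: "nat \<Rightarrow> nat \<Rightarrow> real" where
  "Sigma_mat i j = (1/2) * ((if i = j then 1 else 0) + 1)"

lemma ex_is_factor_scaled_Sigma_mat:
  assumes "0 \<le> c"
  shows "\<exists>A. is_factor N (\<lambda>i j. c * Sigma_mat i j) A"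
proof (cases "N = 0")
  case True
  then show ?thesis by (auto simp: is_factor_def)
next
  case False
  define a where "a = sqrt (c/2)"
  define b where "b = (sqrt (c * (real N + 1) / 2) - a) / real N"
  have a2: "a * a = c/2"
    using assms by (simp add: a_def)
  have "(a + real N * b) * (a + real N * b) = c * (real N + 1) / 2"
    using False assms by (simp add: b_def)
  then have "real N * (2 * a * b + real N * b * b) = real N * (c / 2)"
    using a2 by (simp add: field_simps)
  then have ab: "2 * a * b + real N * b * b = c/2"
    using False by simp
  have "(\<Sum>k=1..N. ((if i = k then a else 0) + b) * ((if j = k then a else 0) + b))
      = c * Sigma_mat i j" if "i \<in> {1..N}" "j \<in> {1..N}" for i j
  proof -
    have "(\<Sum>k=1..N. ((if i = k then a else 0) + b) * ((if j = k then a else 0) + b))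
        = (\<Sum>k=1..N. (if i = k then (if i = j then a * a else 0) else 0)
             + (if i = k then a * b else 0) + (if j = k then a * b else 0) + b * b)"
      by (intro sum.cong refl) (auto simp: algebra_simps)
    also have "\<dots> = (if i = j then a * a else 0) + (2 * a * b + real N * b * b)"
      using that by (simp add: sum.distrib sum.delta)
    also have "\<dots> = c * Sigma_mat i j"
      unfolding ab a2 by (simp add: Sigma_mat_def)
    finally show ?thesis .
  qed
  then have "is_factor N (\<lambda>i j. c * Sigma_mat i j) (\<lambda>i k. (if i = k then a else 0) + b)"
    by (simp add: is_factor_def)
  then show ?thesis by blast
qed

definition select_prob :: "nat \<Rightarrow> (nat \<Rightarrow> real) \<Rightarrow> nat \<Rightarrow> real" where
  "select_prob N h k = exp ((h(0 := 0)) k) / (1 + (\<Sum>m=1..N. exp (h m)))"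

definition V_law ::
  "(real \<Rightarrow> real) \<Rightarrow> (nat \<Rightarrow> real \<Rightarrow> real \<Rightarrow> real) \<Rightarrow> (nat \<Rightarrow> real \<Rightarrow> real) \<Rightarrow>
   (nat \<Rightarrow> real) \<Rightarrow> nat \<Rightarrow> nat \<Rightarrow> nat \<Rightarrow> (nat \<Rightarrow> real) measure" where
  "V_law m1 m G l N T t =
     mv_normal N (\<lambda>i. - (1/2) * l t * fisher_info m1 m G T t)
       (\<lambda>i j. l t * fisher_info m1 m G T t * Sigma_mat i j)"

text \<open>
  Joint law of \<open>(V, K)\<close>: the \<open>V t\<close> are independent, and given \<open>V = v\<close> the vector \<open>K\<close> has
  probability mass function \<open>k \<mapsto> \<Prod>t. select_prob N (v t) (k t)\<close>, i.e. its components are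
  conditionally independent.
\<close>

definition limit_law ::
  "(real \<Rightarrow> real) \<Rightarrow> (nat \<Rightarrow> real \<Rightarrow> real \<Rightarrow> real) \<Rightarrow> (nat \<Rightarrow> real \<Rightarrow> real) \<Rightarrow>
   (nat \<Rightarrow> real) \<Rightarrow> nat \<Rightarrow> nat \<Rightarrow> ((nat \<Rightarrow> nat \<Rightarrow> real) \<times> (nat \<Rightarrow> nat)) measure" where
  "limit_law m1 m G l N T =
     density
       ((\<Pi>\<^sub>M t\<in>{1..T}. V_law m1 m G l N T t) \<Otimes>\<^sub>M (\<Pi>\<^sub>M t\<in>{1..T}. count_space {0..N}))
       (\<lambda>(v, k). ennreal (\<Prod>t=1..T. select_prob N (v t) (k t)))"

definition accept_rate ::
  "(real \<Rightarrow> real) \<Rightarrow> (nat \<Rightarrow> real \<Rightarrow> real \<Rightarrow> real) \<Rightarrow> (nat \<Rightarrow> real \<Rightarrow> real) \<Rightarrow>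
   (nat \<Rightarrow> real) \<Rightarrow> nat \<Rightarrow> nat \<Rightarrow> nat \<Rightarrow> real" where
  "accept_rate m1 m G l N T t =
     measure (limit_law m1 m G l N T)
       {\<omega> \<in> space (limit_law m1 m G l N T). snd \<omega> t \<noteq> 0}"

definition sup_info ::
  "(real \<Rightarrow> real) \<Rightarrow> (nat \<Rightarrow> real \<Rightarrow> real \<Rightarrow> real) \<Rightarrow> (nat \<Rightarrow> real \<Rightarrow> real) \<Rightarrow>
   (nat \<Rightarrow> real) \<Rightarrow> ereal" where
  "sup_info m1 m G l = (SUP T\<in>{1..}. SUP t\<in>{1..T}. ereal (l t * fisher_info m1 m G T t))"

end

theory Submission
  imports Defs
begin

text \<open>
  Write \<open>S = \<Sum>\<^sub>k exp (V\<^sub>k)\<close> and \<open>s = \<ell>\<^sub>t \<I>\<^bsub>t|T\<^esub>\<close>. The acceptance rate is the expectation of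
  \<open>S / (1 + S) = 1 / (1 + 1/S)\<close>, a convex function of \<open>1/S\<close>, so Jensen bounds it below by
  \<open>1 / (1 + E[1/S])\<close>. The inequality between arithmetic and harmonic means gives
  \<open>1/S \<le> (\<Sum>\<^sub>k exp (- V\<^sub>k)) / N\<^sup>2\<close>, whose expectation is \<open>exp s / N\<close> because
  each \<open>V\<^sub>k\<close> is \<open>N(- s/2, s)\<close>.
\<close>

section \<open>Exponential moments of Gaussian vectors\<close>

lemma std_normal_exp_moment:
  fixes a :: real
  shows "has_bochner_integral std_normal_distribution (\<lambda>z. exp (a * z)) (exp (a\<^sup>2 / 2))"
proof -
  \<comment> \<open>Completing the square: tilting the standard normal by \<open>exp (a * z)\<close>
    moves its mean to \<open>a\<close>, leaving the factor \<open>exp (a^2 / 2)\<close>.\<close>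
  have eq: "std_normal_density z * exp (a * z) = exp (a\<^sup>2 / 2) * normal_density a 1 z" for z
    by (simp add: normal_density_def exp_add [symmetric] field_simps power2_eq_square)
  have "has_bochner_integral lborel (\<lambda>z. exp (a\<^sup>2 / 2) * normal_density a 1 z) (exp (a\<^sup>2 / 2) * 1)"
    by (intro has_bochner_integral_mult_right)
       (simp_all add: has_bochner_integral_iff integral_normal_density)
  then show ?thesis
    by (subst has_bochner_integral_iff)
       (simp add: has_bochner_integral_iff integrable_density integral_density eq)
qed

lemma sets_mv_normal [measurable_cong, simp]:
  "sets (mv_normal N \<mu> C) = sets (\<Pi>\<^sub>M i\<in>{1..N}. borel)"
  by (simp add: mv_normal_def Let_def)

lemma affine_map_measurable:
  "(\<lambda>z. \<lambda>i\<in>{1..N}. \<mu> i + (\<Sum>k=1..N. A i k * z k))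
     \<in> (\<Pi>\<^sub>M k\<in>{1..N}. std_normal_distribution) \<rightarrow>\<^sub>M (\<Pi>\<^sub>M i\<in>{1..N}. (borel :: real measure))"
  by measurable

lemma prob_space_mv_normal: "prob_space (mv_normal N \<mu> C)"
  unfolding mv_normal_def Let_def
  by (intro prob_space.prob_space_distr prob_space_PiM affine_map_measurable)
     (simp add: prob_space_normal_density)

text \<open>In the representation \<open>\<mu> + A Z\<close>, the exponential of a component factors
  over the independent \<open>Z k\<close>, so the one-dimensional moments multiply. The exponents
  add up to half the squared norm of row \<open>i\<close> of \<open>A\<close>, which is the diagonal
  entry \<open>C i i\<close>.\<close>

lemma mv_normal_exp_neg_component:
  assumes "\<exists>A. is_factor N C A" and i: "i \<in> {1..N}"
  shows "has_bochner_integral (mv_normal N \<mu> C) (\<lambda>v. exp (- v i)) (exp (C i i / 2 - \<mu> i))"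
proof -
  \<comment> \<open>The chosen \<open>A\<close> is known to be a factor only because one exists,
    hence the first assumption.\<close>
  define A where "A = (SOME A. is_factor N C A)"
  have "is_factor N C A"
    unfolding A_def using assms(1) by (rule someI_ex)
  then have C: "C i i = (\<Sum>k=1..N. (A i k)\<^sup>2)"
    using i by (simp add: is_factor_def power2_eq_square)
  interpret product_sigma_finite "\<lambda>k::nat. std_normal_distribution"
    unfolding product_sigma_finite_def
    by (simp add: prob_space_imp_sigma_finite prob_space_normal_density)
  let ?M = "\<Pi>\<^sub>M k\<in>{1..N}. std_normal_distribution"
  let ?f = "\<lambda>k z. exp (- A i k * z)"
  have moment: "has_bochner_integral std_normal_distribution (?f k) (exp ((A i k)\<^sup>2 / 2))" for k
    using std_normal_exp_moment[of "- A i k"] by simp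
  have "has_bochner_integral ?M (\<lambda>z. \<Prod>k\<in>{1..N}. ?f k (z k)) (\<Prod>k\<in>{1..N}. exp ((A i k)\<^sup>2 / 2))"
    unfolding has_bochner_integral_iff
    using moment by (subst product_integral_prod)
      (auto simp: has_bochner_integral_iff intro!: product_integrable_prod)
  then have "has_bochner_integral ?M (\<lambda>z. exp (- \<mu> i) * (\<Prod>k\<in>{1..N}. ?f k (z k)))
      (exp (- \<mu> i) * (\<Prod>k\<in>{1..N}. exp ((A i k)\<^sup>2 / 2)))"
    by (rule has_bochner_integral_mult_right)
  moreover have "exp (- \<mu> i) * (\<Prod>k\<in>{1..N}. ?f k (z k))
      = exp (- (\<lambda>i\<in>{1..N}. \<mu> i + (\<Sum>k=1..N. A i k * z k)) i)" for z
    using i by (simp add: exp_sum [symmetric] exp_add [symmetric] sum_negf)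
  moreover have "exp (- \<mu> i) * (\<Prod>k\<in>{1..N}. exp ((A i k)\<^sup>2 / 2)) = exp (C i i / 2 - \<mu> i)"
    by (simp add: C exp_sum [symmetric] exp_add [symmetric] sum_divide_distrib)
  ultimately have "has_bochner_integral ?M
      (\<lambda>z. exp (- (\<lambda>i\<in>{1..N}. \<mu> i + (\<Sum>k=1..N. A i k * z k)) i)) (exp (C i i / 2 - \<mu> i))"
    by simp
  moreover have "(\<lambda>v::nat\<Rightarrow>real. exp (- v i)) \<in> borel_measurable (\<Pi>\<^sub>M i\<in>{1..N}. borel)"
    using i by measurable
  ultimately show ?thesis
    unfolding mv_normal_def Let_def A_def [symmetric]
    by (intro has_bochner_integral_distr[OF _ affine_map_measurable])
qed

section \<open>Selection probabilities\<close>

lemma select_prob_nonneg: "0 \<le> select_prob N h k"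
  by (simp add: select_prob_def sum_nonneg add_nonneg_nonneg)

lemma sum_select_prob_accept:
  "(\<Sum>k=1..N. select_prob N h k) = (\<Sum>k=1..N. exp (h k)) / (1 + (\<Sum>k=1..N. exp (h k)))"
  by (simp add: select_prob_def sum_divide_distrib)

lemma sum_select_prob: "(\<Sum>k=0..N. select_prob N h k) = 1"
proof -
  have "0 < 1 + (\<Sum>k=1..N. exp (h k))"
    by (simp add: add_pos_nonneg sum_nonneg)
  moreover have "(\<Sum>k=0..N. select_prob N h k)
      = select_prob N h 0 + (\<Sum>k=1..N. select_prob N h k)"
    by (simp add: sum.atLeast_Suc_atMost)
  ultimately show ?thesis
    by (simp only: sum_select_prob_accept) (simp add: select_prob_def add_divide_distrib [symmetric])
qed

lemma select_prob_measurable: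
  assumes "k \<in> {0..N}"
  shows "(\<lambda>h. select_prob N h k) \<in> borel_measurable (\<Pi>\<^sub>M i\<in>{1..N}. borel)"
proof -
  have "(\<lambda>h::nat\<Rightarrow>real. (h(0 := 0)) k) \<in> borel_measurable (\<Pi>\<^sub>M i\<in>{1..N}. borel)"
    \<comment> \<open>Index 0 reads the overwritten value 0; every other index is a coordinate of
      the product space.\<close>
    using assms by (cases "k = 0") auto
  then show ?thesis
    unfolding select_prob_def by measurable
qed

text \<open>
  Tangent line at \<open>x = c\<close> of the convex function \<open>x \<mapsto> 1 / (1 + x)\<close>: integrating it replaces
  Jensen's inequality.
\<close>

lemma sum_select_prob_lower_bound:
  assumes N: "1 \<le> N" and c: "0 \<le> c"
  shows "inverse (1 + c) + (c - (\<Sum>k=1..N. exp (- h k)) / (real N)\<^sup>2) / (1 + c)\<^sup>2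
           \<le> (\<Sum>k=1..N. select_prob N h k)"
proof -
  define S where "S = (\<Sum>k=1..N. exp (h k))"
  define R where "R = (\<Sum>k=1..N. exp (- h k))"
  have S: "0 < S"
    unfolding S_def using N by (intro sum_pos) auto
  \<comment> \<open>Cauchy-Schwarz for two vectors whose entrywise products are all 1; this is the
    harmonic mean inequality \<open>N^2 \<le> S * R\<close>.\<close>
  have "(\<Sum>k=1..N. exp (h k / 2) * exp (- h k / 2))\<^sup>2
      \<le> (\<Sum>k=1..N. (exp (h k / 2))\<^sup>2) * (\<Sum>k=1..N. (exp (- h k / 2))\<^sup>2)"
    by (rule Cauchy_Schwarz_ineq_sum)
  then have "(real N)\<^sup>2 \<le> S * R"
    by (simp add: S_def R_def exp_add [symmetric] exp_double [symmetric])
  then have "1 / S \<le> R / (real N)\<^sup>2"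
    using S N by (simp add: field_simps)
  then have "inverse (1 + c) + (c - R / (real N)\<^sup>2) / (1 + c)\<^sup>2
      \<le> inverse (1 + c) + (c - 1 / S) / (1 + c)\<^sup>2"
    by (intro add_left_mono divide_right_mono) auto
  also have "\<dots> \<le> S / (1 + S)"
  proof -
    \<comment> \<open>The gap between the convex function and its tangent is a perfect square over a
      positive denominator; for \<open>c > 0\<close> it vanishes at the point of tangency
      \<open>1 / S = c\<close>.\<close>
    have "S / (1 + S) - (inverse (1 + c) + (c - 1 / S) / (1 + c)\<^sup>2)
        = (S * c - 1)\<^sup>2 / (S * (1 + S) * (1 + c)\<^sup>2)"
      using S c by (simp add: divide_simps power2_eq_square) (simp add: algebra_simps)
    also have "\<dots> \<ge> 0"
      using S by simp
    finally show ?thesis by simp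
  qed
  finally show ?thesis
    by (simp only: sum_select_prob_accept S_def R_def)
qed

section \<open>The acceptance rate as an expectation over a single \<open>V t\<close>\<close>

lemma accept_rate_eq_integral:
  assumes t: "t \<in> {1..T}"
  shows "accept_rate m1 m G l N T t
           = (\<integral>v. (\<Sum>k=1..N. select_prob N v k) \<partial>V_law m1 m G l N T t)"
proof -
  let ?V = "V_law m1 m G l N T"
  let ?B = "\<Pi>\<^sub>M i\<in>{1..N}. (borel :: real measure)"
  let ?K = "count_space {0..N}"
  let ?P = "\<Pi>\<^sub>M t\<in>{1..T}. ?V t"
  let ?Q = "\<Pi>\<^sub>M t\<in>{1..T}. ?K"
  let ?f = "\<lambda>(v, k). ennreal (\<Prod>s=1..T. select_prob N (v s) (k s))"
  let ?A = "{\<omega> \<in> space (?P \<Otimes>\<^sub>M ?Q). snd \<omega> t \<noteq> 0}"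
  have setsV [measurable_cong, simp]: "sets (?V s) = sets ?B" for s
    by (simp add: V_law_def)
  have probV: "prob_space (?V s)" for s
    by (simp add: V_law_def prob_space_mv_normal)
  interpret K: product_sigma_finite "\<lambda>s::nat. ?K"
    unfolding product_sigma_finite_def by (simp add: sigma_finite_measure_count_space_finite)
  interpret Q: sigma_finite_measure ?Q
    by (rule K.sigma_finite) simp
  \<comment> \<open>The indicator of acceptance at \<open>t\<close> is absorbed into the factor
    \<open>s = t\<close>, so that density times indicator remains a product over \<open>s\<close>
    and can be integrated one coordinate of \<open>K\<close> at a time.\<close>
  define g where "g s h k = ennreal (select_prob N h k) * (if s = t \<and> k = 0 then 0 else 1)"
    for s h k
  \<comment> \<open>Joint measurability follows by fixing each of the finitely many values of the
    index.\<close>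
  have "(\<lambda>\<omega>. select_prob N (fst \<omega> s) (snd \<omega> s)) \<in> borel_measurable (?P \<Otimes>\<^sub>M ?Q)"
    if s: "s \<in> {1..T}" for s
  proof (rule measurable_compose_countable'[where I = "{0..N}"])
    have "(\<lambda>\<omega>. fst \<omega> s) \<in> (?P \<Otimes>\<^sub>M ?Q) \<rightarrow>\<^sub>M ?B"
      using s by measurable
    then show "(\<lambda>\<omega>. select_prob N (fst \<omega> s) k) \<in> borel_measurable (?P \<Otimes>\<^sub>M ?Q)"
      if "k \<in> {0..N}" for k
      using select_prob_measurable[OF that] by (rule measurable_compose)
    show "(\<lambda>\<omega>. snd \<omega> s) \<in> (?P \<Otimes>\<^sub>M ?Q) \<rightarrow>\<^sub>M ?K"
      using s by measurable
  qed simp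
  then have f_meas [measurable]: "?f \<in> borel_measurable (?P \<Otimes>\<^sub>M ?Q)"
    unfolding case_prod_beta by measurable
  have A_meas [measurable]: "?A \<in> sets (?P \<Otimes>\<^sub>M ?Q)"
  proof -
    have "(\<lambda>\<omega>. snd \<omega> t) \<in> (?P \<Otimes>\<^sub>M ?Q) \<rightarrow>\<^sub>M ?K"
      using t by measurable
    then have "(\<lambda>\<omega>. snd \<omega> t) -` {1..N} \<inter> space (?P \<Otimes>\<^sub>M ?Q) \<in> sets (?P \<Otimes>\<^sub>M ?Q)"
      by (rule measurable_sets) auto
    moreover have "?A = (\<lambda>\<omega>. snd \<omega> t) -` {1..N} \<inter> space (?P \<Otimes>\<^sub>M ?Q)"
      using t by (auto simp: space_pair_measure space_PiM PiE_def Pi_def Suc_le_eq)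
    ultimately show ?thesis by simp
  qed
  have int_meas: "(\<lambda>v. \<Sum>k=1..N. select_prob N v k) \<in> borel_measurable (?V t)"
    unfolding measurable_cong_sets[OF setsV refl]
    by (intro borel_measurable_sum select_prob_measurable) auto
  have fg: "?f (v, k) * indicator ?A (v, k) = (\<Prod>s=1..T. g s (v s) (k s))"
    if "v \<in> space ?P" "k \<in> space ?Q" for v k
  proof (cases "k t = 0")
    case True
    then show ?thesis
      using t by (subst (2) prod_zero) (auto simp: g_def intro!: bexI[of _ t])
  next
    case False
    then have "(\<Prod>s=1..T. g s (v s) (k s)) = (\<Prod>s=1..T. ennreal (select_prob N (v s) (k s)))"
      by (intro prod.cong) (auto simp: g_def)
    then show ?thesis
      using that False by (simp add: prod_ennreal select_prob_nonneg space_pair_measure)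
  qed
  have g_sum: "(\<integral>\<^sup>+ k. g s h k \<partial>?K)
      = (if s = t then ennreal (\<Sum>k=1..N. select_prob N h k) else 1)" for s h
  proof -
    have "(\<integral>\<^sup>+ k. g s h k \<partial>?K) = (\<Sum>k=0..N. g s h k)"
      by (simp add: nn_integral_count_space_finite)
    also have "\<dots> = (if s = t then ennreal (\<Sum>k=1..N. select_prob N h k) else 1)"
    proof (cases "s = t")
      case True
      then have "(\<Sum>k=0..N. g s h k) = (\<Sum>k=1..N. g s h k)"
        by (simp add: sum.atLeast_Suc_atMost g_def)
      also have "\<dots> = (\<Sum>k=1..N. ennreal (select_prob N h k))"
        by (intro sum.cong) (auto simp: g_def)
      finally show ?thesis
        using True by (simp add: sum_ennreal select_prob_nonneg)
    next
      case False
      then show ?thesis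
        using sum_select_prob[of N h] by (simp add: g_def sum_ennreal select_prob_nonneg)
    qed
    finally show ?thesis .
  qed
  have "emeasure (limit_law m1 m G l N T) ?A
      = (\<integral>\<^sup>+ \<omega>. ?f \<omega> * indicator ?A \<omega> \<partial>(?P \<Otimes>\<^sub>M ?Q))"
    unfolding limit_law_def by (rule emeasure_density) (rule f_meas A_meas)+
  also have "\<dots> = (\<integral>\<^sup>+ v. \<integral>\<^sup>+ k. ?f (v, k) * indicator ?A (v, k) \<partial>?Q \<partial>?P)"
    by (rule Q.nn_integral_fst [symmetric]) measurable
  also have "\<dots> = (\<integral>\<^sup>+ v. \<integral>\<^sup>+ k. (\<Prod>s=1..T. g s (v s) (k s)) \<partial>?Q \<partial>?P)"
    by (intro nn_integral_cong fg)
  also have "\<dots> = (\<integral>\<^sup>+ v. (\<Prod>s=1..T. \<integral>\<^sup>+ k. g s (v s) k \<partial>?K) \<partial>?P)"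
    by (intro nn_integral_cong K.product_nn_integral_prod) auto
  \<comment> \<open>Summing out \<open>K s\<close> gives 1 for every \<open>s\<close> other than
    \<open>t\<close>, since the selection probabilities add up to 1.\<close>
  also have "\<dots> = (\<integral>\<^sup>+ v. ennreal (\<Sum>k=1..N. select_prob N (v t) k) \<partial>?P)"
    using t by (simp add: g_sum prod.delta)
  also have "\<dots> = (\<integral>\<^sup>+ h. ennreal (\<Sum>k=1..N. select_prob N h k) \<partial>distr ?P (?V t) (\<lambda>v. v t))"
    using t int_meas by (subst nn_integral_distr) auto
  \<comment> \<open>The remaining \<open>V s\<close> integrate out because their laws are
    probability measures.\<close>
  also have "distr ?P (?V t) (\<lambda>v. v t) = ?V t"
    using probV t by (intro distr_PiM_component) auto
  finally have "emeasure (limit_law m1 m G l N T) ?A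
      = (\<integral>\<^sup>+ h. ennreal (\<Sum>k=1..N. select_prob N h k) \<partial>?V t)" .
  then show ?thesis
    using int_meas
    by (simp add: accept_rate_def measure_def integral_eq_nn_integral sum_nonneg select_prob_nonneg
        limit_law_def)
qed

section \<open>The lower bound, for fixed indices and then uniformly\<close>

lemma fisher_info_nonneg: "0 \<le> fisher_info m1 m G T t"
  by (simp add: fisher_info_def)

lemma accept_rate_lower_bound:
  assumes t: "t \<in> {1..T}" and N: "1 \<le> N" and l: "0 \<le> l t"
  shows "inverse (1 + exp (l t * fisher_info m1 m G T t) / real N) \<le> accept_rate m1 m G l N T t"
proof -
  define s where "s = l t * fisher_info m1 m G T t"
  \<comment> \<open>The tangency point is the mean of the bound on \<open>1 / S\<close>, namely
    \<open>N * exp s / N^2\<close>, so the linear term of \<open>?F\<close> integrates to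
    zero.\<close>
  define c where "c = exp s / real N"
  let ?V = "V_law m1 m G l N T t"
  let ?F = "\<lambda>v. inverse (1 + c) + (c - (\<Sum>k=1..N. exp (- v k)) / (real N)\<^sup>2) / (1 + c)\<^sup>2"
  interpret prob_space ?V
    by (simp add: V_law_def prob_space_mv_normal)
  have "0 \<le> s"
    using l by (simp add: s_def fisher_info_nonneg)
  \<comment> \<open>Nonnegativity of \<open>s\<close> supplies a factor of the covariance. As
    \<open>Sigma_mat\<close> has unit diagonal, the variance is \<open>s\<close> and the exponent is
    \<open>s/2 + s/2\<close>.\<close>
  then have "has_bochner_integral ?V (\<lambda>v. exp (- v k)) (exp s)" if "k \<in> {1..N}" for k
    using mv_normal_exp_neg_component[OF ex_is_factor_scaled_Sigma_mat that, of s "\<lambda>_. - (1/2) * s"]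
    by (simp add: V_law_def s_def Sigma_mat_def mult.assoc)
  then have "has_bochner_integral ?V (\<lambda>v. \<Sum>k=1..N. exp (- v k)) (\<Sum>k=1..N. exp s)"
    by (rule has_bochner_integral_sum)
  then have "integrable ?V (\<lambda>v. \<Sum>k=1..N. exp (- v k))"
    and "(\<integral>v. (\<Sum>k=1..N. exp (- v k)) \<partial>?V) = real N * exp s"
    by (simp_all add: has_bochner_integral_iff)
  then have intF: "integrable ?V ?F" and "(\<integral>v. ?F v \<partial>?V) = inverse (1 + c)"
    using N by (simp_all add: prob_space c_def power2_eq_square)
  then have "inverse (1 + c) = (\<integral>v. ?F v \<partial>?V)" by simp
  also have "\<dots> \<le> (\<integral>v. (\<Sum>k=1..N. select_prob N v k) \<partial>?V)"
  proof (rule integral_mono[OF intF])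
    show "integrable ?V (\<lambda>v. \<Sum>k=1..N. select_prob N v k)"
    proof (rule integrable_const_bound[where B = 1])
      show "(\<lambda>v. \<Sum>k=1..N. select_prob N v k) \<in> borel_measurable ?V"
        unfolding V_law_def measurable_cong_sets[OF sets_mv_normal refl]
        by (intro borel_measurable_sum select_prob_measurable) auto
      show "AE v in ?V. norm (\<Sum>k=1..N. select_prob N v k) \<le> 1"
      proof (intro AE_I2)
        fix v
        have "(\<Sum>k=1..N. select_prob N v k) \<le> (\<Sum>k=0..N. select_prob N v k)"
          by (intro sum_mono2) (auto simp: select_prob_nonneg)
        then show "norm (\<Sum>k=1..N. select_prob N v k) \<le> 1"
          by (simp add: sum_select_prob sum_nonneg select_prob_nonneg)
      qed
    qed
    show "?F v \<le> (\<Sum>k=1..N. select_prob N v k)" for v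
      by (rule sum_select_prob_lower_bound[OF N]) (simp add: c_def)
  qed
  also have "\<dots> = accept_rate m1 m G l N T t"
    by (rule accept_rate_eq_integral[OF t, symmetric])
  finally show ?thesis by (simp add: c_def s_def)
qed

theorem corollary3p5:
  fixes m1 :: "real \<Rightarrow> real"
    and m :: "nat \<Rightarrow> real \<Rightarrow> real \<Rightarrow> real"
    and G :: "nat \<Rightarrow> real \<Rightarrow> real"
    and l :: "nat \<Rightarrow> real"
    and N :: nat
  assumes model: "feynman_kac_model m1 m G"
    and scale_pos: "\<And>t. 1 \<le> t \<Longrightarrow> 0 < l t"
    and density_pos: "\<And>T x. \<lbrakk>1 \<le> T; x \<in> Rn T\<rbrakk> \<Longrightarrow> 0 < target_density m1 m G T x"
    and density_C2: "\<And>T. 1 \<le> T \<Longrightarrow> C_k 2 T (target_density m1 m G T)"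
    and hess_lipschitz: "\<And>T s t. \<lbrakk>1 \<le> T; s \<in> {1..T}; t \<in> {1..T}\<rbrakk> \<Longrightarrow>
          lipschitz_Rn T (pdiff s (pdiff t (log_target m1 m G T)))"
    and hess_bounded: "\<And>T s t. \<lbrakk>1 \<le> T; s \<in> {1..T}; t \<in> {1..T}\<rbrakk> \<Longrightarrow>
          bounded (pdiff s (pdiff t (log_target m1 m G T)) ` Rn T)"
    and fourth_moment: "\<And>T t. \<lbrakk>1 \<le> T; t \<in> {1..T}\<rbrakk> \<Longrightarrow>
          (\<integral>\<^sup>+ x. ennreal (\<bar>pdiff t (log_target m1 m G T) x\<bar> ^ 4) \<partial>target m1 m G T) < \<infinity>"
    and info_finite: "sup_info m1 m G l < \<infinity>"
    and N_pos: "1 \<le> N"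
  shows "(INF T\<in>{1..}. INF t\<in>{1..T}. accept_rate m1 m G l N T t)
           \<ge> inverse (1 + exp (real_of_ereal (sup_info m1 m G l)) / real N)
       \<and> inverse (1 + exp (real_of_ereal (sup_info m1 m G l)) / real N) > 0"
proof (intro conjI)
  let ?I = "sup_info m1 m G l"
  show "0 < inverse (1 + exp (real_of_ereal ?I) / real N)"
    by (simp add: add_pos_nonneg)
  have rate: "inverse (1 + exp (real_of_ereal ?I) / real N) \<le> accept_rate m1 m G l N T t"
    if T: "T \<in> {1..}" and t: "t \<in> {1..T}" for T t
  proof -
    let ?s = "l t * fisher_info m1 m G T t"
    have "ereal ?s \<le> ?I"
      unfolding sup_info_def using T t by (intro SUP_upper2[of T] SUP_upper2[of t]) auto
    then have "?s \<le> real_of_ereal ?I"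
      \<comment> \<open>The supremum is not plus infinity by assumption, nor minus infinity since it
        dominates a real number, so the conversion to a real is faithful.\<close>
      using info_finite by (cases ?I) auto
    then have "inverse (1 + exp (real_of_ereal ?I) / real N) \<le> inverse (1 + exp ?s / real N)"
      by (intro le_imp_inverse_le add_left_mono divide_right_mono) (auto intro: add_pos_nonneg)
    also have "\<dots> \<le> accept_rate m1 m G l N T t"
      using t N_pos scale_pos[of t] by (intro accept_rate_lower_bound) auto
    finally show ?thesis .
  qed
  show "inverse (1 + exp (real_of_ereal ?I) / real N)
      \<le> (INF T\<in>{1..}. INF t\<in>{1..T}. accept_rate m1 m G l N T t)"
    \<comment> \<open>For these real-valued infima a common lower bound suffices once the index sets
      are nonempty; \<open>{1..T}\<close> is, because \<open>T\<close> is at least 1.\<close>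
    by (intro cINF_greatest rate) auto
qed

end
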